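(* For all $x\ge 0$, $$g_\pi(x)\le V_0(x)<g_4(x),$$ and equality in the first inequality holds only at $x=0$, where $g_\pi(0)=V_0(0)=\sqrt{\pi}$. These inequalities are optimal for functions of the form $g_k$: if $k>\pi$, then $g_k(x)\le V_0(x)$ fails for some $x\ge 0$, and if $0<k<4$, then $V_0(x)\le g_k(x)$ fails for some $x\ge 0$.
   Context: For $x\ge 0$, $V_0(x)=2e^{x^2}\int_x^\infty e^{-t^2}\,dt$. For real $k>0$ and $x\ge 0$, $g_k(x)=\dfrac{k}{(k-1)x+\sqrt{x^2+k}}$. *)

theory Defs
  imports "HOL-Analysis.Analysis"
begin

definition V0 :: "real \<Rightarrow> real" where
  "V0 x = 2 * exp (x\<^sup>2) * integral {x..} (\<lambda>t. exp (- (t\<^sup>2)))"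

definition g :: "real \<Rightarrow> real \<Rightarrow> real" where
  "g k x = k / ((k - 1) * x + sqrt (x\<^sup>2 + k))"

end

theory Submission
  imports Defs "HOL-Probability.Distributions" "HOL-Real_Asymp.Real_Asymp"
begin

text \<open>
  The function \<^term>\<open>V0\<close> is, up to the factor \<open>2 * exp (x\<^sup>2)\<close>, the tail of the Gaussian integral, so
  instead of comparing \<^term>\<open>g k\<close> with \<^term>\<open>V0\<close> directly one removes that factor and studies
  the gap \<open>exp (- x\<^sup>2) * (g k x - V0 x)\<close>. It has the same sign as \<open>g k x - V0 x\<close>, it tends to 0 at
  infinity, and its derivative contains no integral any more. The decisive point is that this
  derivative factors (lemma \<open>gap_has_derivative\<close>): in terms of the slope
  \<open>s = x / sqrt (x\<^sup>2 + k)\<close>, which increases from 0 to 1 as \<open>x\<close> runs through \<open>[0, \<infinity>)\<close>, it is a positive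
  multiple of \<open>s - (k - 3)\<close>. Everything follows from this one sign:

  For \<open>k = 4\<close> the derivative is negative throughout, so the gap decreases strictly to its limit 0 and
  is positive. For \<open>k = pi\<close> the gap vanishes at 0 by the value of the Gaussian integral; since
  \<open>0 < pi - 3 < 1\<close>, it first decreases strictly and then increases strictly to its limit 0, so it is
  negative away from 0. For \<open>k < 4\<close> the derivative is positive from some point on, where the gap
  increases to 0 and hence is negative: the upper bound fails far out. For \<open>k > pi\<close> the lower bound
  already fails at 0, where the two functions are \<open>sqrt k\<close> and \<open>sqrt pi\<close>.
\<close>

section \<open>The Gaussian tail\<close>

definition gauss_tail :: "real \<Rightarrow> real" where
  "gauss_tail x = integral {x..} (\<lambda>t. exp (- (t\<^sup>2)))"

text \<open>Completing the square, \<open>(t - 1/2)\<^sup>2 \<ge> 0\<close>, yields an integrable majorant that is valid on every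
  half line, whatever the sign of its end point.\<close>

lemma gauss_le_exp: "exp (- (t\<^sup>2)) \<le> exp (1/4) * exp (- t)" for t :: real
proof -
  have "0 \<le> (t - 1/2)\<^sup>2" by simp
  then have "- (t\<^sup>2) \<le> 1/4 + - t"
    by (simp add: power2_eq_square algebra_simps)
  then show ?thesis
    by (simp flip: exp_add)
qed

lemma majorant_has_integral:
  "((\<lambda>t::real. exp (1/4) * exp (- t)) has_integral (exp (1/4) * exp (- c))) {c..}"
  using has_integral_mult_right[OF has_integral_exp_minus_to_infinity[of 1 c], of "exp (1/4)"]
  by simp

lemma gauss_integrable_atLeast: "(\<lambda>t::real. exp (- (t\<^sup>2))) integrable_on {c..}"
proof (rule measurable_bounded_by_integrable_imp_integrable)
  show "(\<lambda>t::real. exp (- (t\<^sup>2))) \<in> borel_measurable (lebesgue_on {c..})"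
    by (intro continuous_imp_measurable_on_sets_lebesgue continuous_intros) auto
  show "(\<lambda>t::real. exp (1/4) * exp (- t)) integrable_on {c..}"
    using majorant_has_integral by blast
  show "norm (exp (- (t\<^sup>2))) \<le> exp (1/4) * exp (- t)" if "t \<in> {c..}" for t :: real
    using gauss_le_exp[of t] by simp
qed auto

lemma gauss_tail_tendsto_0: "(gauss_tail \<longlongrightarrow> 0) at_top"
proof (rule tendsto_sandwich)
  show "\<forall>\<^sub>F x in at_top. 0 \<le> gauss_tail x"
    unfolding gauss_tail_def
    by (intro always_eventually allI integral_nonneg gauss_integrable_atLeast) auto
  have "gauss_tail x \<le> exp (1/4) * exp (- x)" for x
    unfolding gauss_tail_def
    by (rule has_integral_le[OF integrable_integral[OF gauss_integrable_atLeast]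
          majorant_has_integral]) (rule gauss_le_exp)
  then show "\<forall>\<^sub>F x in at_top. gauss_tail x \<le> exp (1/4) * exp (- x)"
    by simp
  show "((\<lambda>x::real. exp (1/4) * exp (- x)) \<longlongrightarrow> 0) at_top"
    by real_asymp
qed simp

text \<open>Near \<open>x\<close> the tail from \<open>u\<close> splits at \<open>x + 1\<close> into an integral over a compact interval, to which
  the fundamental theorem applies, and a constant.\<close>

lemma gauss_tail_has_derivative:
  "(gauss_tail has_real_derivative - exp (- (x\<^sup>2))) (at x)"
proof -
  let ?f = "\<lambda>t::real. exp (- (t\<^sup>2))"
  have "((\<lambda>u. integral {u..x+1} ?f) has_real_derivative - ?f x) (at x within {x-1..x+1})"
    by (rule integral_has_real_derivative') (auto intro!: continuous_intros)
  then have "((\<lambda>u. integral {u..x+1} ?f) has_real_derivative - ?f x) (at x)"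
    using at_within_Icc_at[of "x - 1" x "x + 1"] by simp
  then have "((\<lambda>u. integral {u..x+1} ?f + gauss_tail (x+1)) has_real_derivative - ?f x) (at x)"
    by (auto intro!: derivative_eq_intros)
  moreover have "\<forall>\<^sub>F u in nhds x. gauss_tail u = integral {u..x+1} ?f + gauss_tail (x+1)"
  proof -
    have "\<forall>\<^sub>F u in nhds x. u < x + 1"
      by (rule order_tendstoD[OF filterlim_ident]) simp
    then show ?thesis
    proof (rule eventually_mono)
      fix u assume u: "u < x + 1"
      have "{u..x+1} \<inter> {x+1..} = {x+1}" "{u..x+1} \<union> {x+1..} = {u..}"
        using u by auto
      moreover have "integral ({u..x+1} \<union> {x+1..}) ?f
          = integral {u..x+1} ?f + integral {x+1..} ?f"
        by (rule integral_Un)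
          (use calculation in \<open>auto intro!: gauss_integrable_atLeast integrable_continuous_real
            continuous_intros\<close>)
      ultimately show "gauss_tail u = integral {u..x+1} ?f + gauss_tail (x+1)"
        by (simp add: gauss_tail_def)
    qed
  qed
  ultimately show ?thesis
    by (subst DERIV_cong_ev[OF refl _ refl]) auto
qed

lemma gauss_tail_0: "gauss_tail 0 = sqrt pi / 2"
proof -
  have "set_integrable lborel {0..} (\<lambda>t::real. exp (- (t\<^sup>2)))"
    and "set_lebesgue_integral lborel {0..} (\<lambda>t::real. exp (- (t\<^sup>2))) = sqrt pi / 2"
    using gaussian_moment_0
    by (simp_all add: has_bochner_integral_iff set_integrable_def set_lebesgue_integral_def)
  then show ?thesis
    unfolding gauss_tail_def by (metis set_borel_integral_eq_integral(2))
qed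

lemma V0_eq_gauss_tail: "V0 x = 2 * exp (x\<^sup>2) * gauss_tail x"
  by (simp add: V0_def gauss_tail_def)

section \<open>The gap and its derivative\<close>

definition slope :: "real \<Rightarrow> real \<Rightarrow> real" where
  "slope k x = x / sqrt (x\<^sup>2 + k)"

definition gap :: "real \<Rightarrow> real \<Rightarrow> real" where
  "gap k x = exp (- (x\<^sup>2)) * g k x - 2 * gauss_tail x"

lemma gap_eq: "gap k x = exp (- (x\<^sup>2)) * (g k x - V0 x)"
  by (simp add: gap_def V0_eq_gauss_tail algebra_simps flip: exp_add)

lemma gap_sign_iff:
  shows gap_pos_iff: "0 < gap k x \<longleftrightarrow> V0 x < g k x"
    and gap_neg_iff: "gap k x < 0 \<longleftrightarrow> g k x < V0 x"
  by (auto simp: gap_eq zero_less_mult_iff mult_less_0_iff)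

context
  fixes k :: real
  assumes k: "0 < k"
begin

lemma less_sqrt_add: "x < sqrt (x\<^sup>2 + k)"
  using k by (intro real_less_rsqrt) simp

lemma slope_nonneg: "0 \<le> x \<Longrightarrow> 0 \<le> slope k x"
  using k by (simp add: slope_def)

lemma slope_less_1: "slope k x < 1"
  using less_sqrt_add[of x] k by (simp add: slope_def add_nonneg_pos)

lemma slope_strict_mono:
  assumes "0 \<le> x" "x < y"
  shows "slope k x < slope k y"
proof -
  have "x\<^sup>2 < y\<^sup>2"
    using assms by (simp add: power_strict_mono)
  then have "x\<^sup>2 * (y\<^sup>2 + k) < y\<^sup>2 * (x\<^sup>2 + k)"
    using k by (simp add: algebra_simps)
  then have "sqrt (x\<^sup>2 * (y\<^sup>2 + k)) < sqrt (y\<^sup>2 * (x\<^sup>2 + k))"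
    by simp
  then have "x * sqrt (y\<^sup>2 + k) < y * sqrt (x\<^sup>2 + k)"
    using assms by (simp add: real_sqrt_mult)
  then show ?thesis
    using k by (simp add: slope_def add_nonneg_pos divide_simps)
qed

lemma slope_tendsto_1: "(slope k \<longlongrightarrow> 1) at_top"
  unfolding slope_def using k by real_asymp

lemma g_denominator_bound:
  assumes "0 \<le> x"
  shows "k * x < (k - 1) * x + sqrt (x\<^sup>2 + k)"
  using less_sqrt_add[of x] by (simp add: algebra_simps)

lemma g_denominator_pos:
  assumes "0 \<le> x"
  shows "0 < (k - 1) * x + sqrt (x\<^sup>2 + k)"
  using g_denominator_bound[OF assms] k assms by (smt (verit) mult_nonneg_nonneg)

text \<open>The integral disappears because the tail differentiates to \<open>- exp (- x\<^sup>2)\<close>: what remains is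
  \<open>exp (- x\<^sup>2) * (g' - 2 x g + 2)\<close>. With \<open>y = sqrt (x\<^sup>2 + k)\<close> and the relation \<open>k = y\<^sup>2 - x\<^sup>2\<close>, the
  second factor is, up to a positive multiple, a quadratic polynomial in the slope \<open>x / y\<close> with the
  roots \<open>1\<close> and \<open>k - 3\<close>. The root \<open>1\<close> is the limit of the slope and is never attained,
  so only \<open>k - 3\<close> matters for the sign.\<close>

lemma gap_has_derivative:
  assumes x: "0 \<le> x"
  shows "(gap k has_real_derivative
    exp (- (x\<^sup>2)) * (k * (1 - slope k x) /
      ((1 + slope k x) * ((k - 1) * x + sqrt (x\<^sup>2 + k))\<^sup>2)) * (slope k x - (k - 3))) (at x)"
proof -
  define y where "y = sqrt (x\<^sup>2 + k)"
  define D where "D = (k - 1) * x + y"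
  have y: "0 < y" and y2: "y\<^sup>2 = x\<^sup>2 + k"
    using k by (simp_all add: y_def add_nonneg_pos)
  have D: "0 < D"
    using g_denominator_pos[OF x] by (simp add: D_def y_def)
  have xk: "0 < x\<^sup>2 + k" using k by (simp add: add_nonneg_pos)
  have "((\<lambda>x. sqrt (x\<^sup>2 + k)) has_real_derivative x / y) (at x)"
    unfolding y_def using xk
    by (intro DERIV_cong[OF DERIV_chain2[OF DERIV_real_sqrt]]) (auto intro!: derivative_eq_intros simp: divide_simps)
  then have "((\<lambda>x. (k - 1) * x + sqrt (x\<^sup>2 + k)) has_real_derivative (k - 1) + x / y) (at x)"
    using DERIV_add[OF DERIV_cmult_Id[of "k - 1"]] by blast
  from DERIV_divide[OF DERIV_const[of k] this]
  have "(g k has_real_derivative - k * ((k - 1) + x / y) / D\<^sup>2) (at x)"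
    using D by (simp add: g_def[abs_def] D_def y_def power2_eq_square)
  then have "(gap k has_real_derivative
      exp (- (x\<^sup>2)) * (- (2 * x)) * g k x + exp (- (x\<^sup>2)) * (- k * ((k - 1) + x / y) / D\<^sup>2)
        + 2 * exp (- (x\<^sup>2))) (at x)"
    unfolding gap_def
    by (auto intro!: derivative_eq_intros gauss_tail_has_derivative)
  moreover have "- (2 * x) * (k / D) - k * ((k - 1) + x / y) / D\<^sup>2 + 2
      = k * (1 - x / y) / ((1 + x / y) * D\<^sup>2) * (x / y - (k - 3))"
  proof -
    have xy: "0 < x + y" using x y by simp
    have "((2 * D\<^sup>2 - 2 * x * k * D) * y - k * ((k - 1) * y + x)) * (x + y)
        = k * (y - x) * (x - (k - 3) * y)"
      using y2 unfolding D_def by algebra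
    then have "((2 * D\<^sup>2 - 2 * x * k * D) * y - k * ((k - 1) * y + x)) / (D\<^sup>2 * y)
        = k * (y - x) * (x - (k - 3) * y) / (D\<^sup>2 * y * (x + y))"
      using y D xy by (metis less_irrefl nonzero_mult_divide_mult_cancel_right)
    moreover have "- (2 * x) * (k / D) - k * ((k - 1) + x / y) / D\<^sup>2 + 2
        = ((2 * D\<^sup>2 - 2 * x * k * D) * y - k * ((k - 1) * y + x)) / (D\<^sup>2 * y)"
    proof -
      have "k / D = k * D * y / (D\<^sup>2 * y)" "(k - 1) + x / y = ((k - 1) * y + x) / y"
        "2 = 2 * D\<^sup>2 * y / (D\<^sup>2 * y)"
        using y D by (simp_all add: power2_eq_square add_divide_distrib)
      then have "- (2 * x) * (k / D) - k * ((k - 1) + x / y) / D\<^sup>2 + 2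
          = - (2 * x) * (k * D * y / (D\<^sup>2 * y)) - k * (((k - 1) * y + x) / y) / D\<^sup>2
            + 2 * D\<^sup>2 * y / (D\<^sup>2 * y)"
        by metis
      also have "\<dots> = ((2 * D\<^sup>2 - 2 * x * k * D) * y - k * ((k - 1) * y + x)) / (D\<^sup>2 * y)"
        by (simp add: add_divide_distrib diff_divide_distrib ring_distribs mult_ac)
      finally show ?thesis .
    qed
    moreover have "k * (1 - x / y) / ((1 + x / y) * D\<^sup>2) * (x / y - (k - 3))
        = k * (y - x) * (x - (k - 3) * y) / (D\<^sup>2 * y * (x + y))"
    proof -
      have "1 - x / y = (y - x) / y" "1 + x / y = (x + y) / y"
        "x / y - (k - 3) = (x - (k - 3) * y) / y"
        using y by (simp_all add: field_simps)
      then show ?thesis using y D xy by simp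
    qed
    ultimately show ?thesis by simp
  qed
  then have "exp (- (x\<^sup>2)) * (- (2 * x) * (k / D) - k * ((k - 1) + x / y) / D\<^sup>2 + 2)
      = exp (- (x\<^sup>2)) * (k * (1 - x / y) / ((1 + x / y) * D\<^sup>2)) * (x / y - (k - 3))"
    by (simp only: mult.assoc)
  moreover have "exp (- (x\<^sup>2)) * (- (2 * x)) * g k x
        + exp (- (x\<^sup>2)) * (- k * ((k - 1) + x / y) / D\<^sup>2) + 2 * exp (- (x\<^sup>2))
      = exp (- (x\<^sup>2)) * (- (2 * x) * (k / D) - k * ((k - 1) + x / y) / D\<^sup>2 + 2)"
  proof -
    have "g k x = k / D" by (simp add: g_def D_def y_def)
    moreover have "e * (- (2 * x)) * a + e * (- k * b / D\<^sup>2) + 2 * e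
        = e * (- (2 * x) * a - k * b / D\<^sup>2 + 2)" for e a b :: real
      by (simp add: distrib_left right_diff_distrib)
    ultimately show ?thesis by metis
  qed
  ultimately show ?thesis
    by (metis slope_def D_def y_def)
qed

lemma gap_derivative_sign:
  assumes "0 \<le> x"
  shows "\<exists>c>0. (gap k has_real_derivative c * (slope k x - (k - 3))) (at x)"
proof (intro exI conjI)
  show "0 < exp (- (x\<^sup>2)) * (k * (1 - slope k x) /
      ((1 + slope k x) * ((k - 1) * x + sqrt (x\<^sup>2 + k))\<^sup>2))"
    using k slope_nonneg[OF assms] slope_less_1[of x] g_denominator_pos[OF assms]
    by (intro mult_pos_pos divide_pos_pos zero_less_power) auto
qed (rule gap_has_derivative[OF assms])

lemma gap_tendsto_0: "(gap k \<longlongrightarrow> 0) at_top"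
proof -
  have "((\<lambda>x. exp (- (x\<^sup>2)) * g k x) \<longlongrightarrow> 0) at_top"
  proof (rule tendsto_sandwich)
    show "\<forall>\<^sub>F x in at_top. 0 \<le> exp (- (x\<^sup>2)) * g k x"
      using eventually_ge_at_top[of 0]
      by eventually_elim (use k g_denominator_pos in \<open>simp add: g_def less_imp_le\<close>)
    show "\<forall>\<^sub>F x in at_top. exp (- (x\<^sup>2)) * g k x \<le> exp (- (x\<^sup>2)) * (1 / x)"
      using eventually_gt_at_top[of 0]
    proof eventually_elim
      case (elim x)
      have "g k x \<le> k / (k * x)"
        unfolding g_def using k elim g_denominator_bound[of x] g_denominator_pos[of x]
        by (intro divide_left_mono mult_pos_pos) auto
      then show ?case
        using k elim by (intro mult_left_mono) simp_all
    qed
    show "((\<lambda>x::real. exp (- (x\<^sup>2)) * (1 / x)) \<longlongrightarrow> 0) at_top"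
      by real_asymp
  qed simp
  from tendsto_diff[OF this tendsto_mult[OF tendsto_const[of 2] gauss_tail_tendsto_0]]
  show ?thesis by (simp add: gap_def[abs_def])
qed

section \<open>The sign of the gap\<close>

text \<open>Where the slope exceeds \<open>k - 3\<close>, it does so forever after, and the gap increases strictly to its
  limit 0.\<close>

lemma gap_neg_if_slope_large:
  assumes "0 \<le> x" "k - 3 < slope k x"
  shows "gap k x < 0"
proof -
  have "\<exists>d. ((\<lambda>t. - gap k t) has_real_derivative d) (at t) \<and> d < 0" if t: "x \<le> t" for t
  proof -
    have "k - 3 < slope k t"
      using assms t slope_strict_mono[of x t] by (cases "x = t") auto
    moreover obtain c where "0 < c" "(gap k has_real_derivative c * (slope k t - (k - 3))) (at t)"
      using gap_derivative_sign[of t] order_trans[OF assms(1) t] by blast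
    ultimately show ?thesis
      by (intro exI[of _ "- (c * (slope k t - (k - 3)))"] conjI DERIV_minus) simp_all
  qed
  moreover have "((\<lambda>t. - gap k t) \<longlongrightarrow> 0) at_top"
    using tendsto_minus[OF gap_tendsto_0] by simp
  ultimately show ?thesis
    using DERIV_neg_imp_decreasing_at_top[of x "\<lambda>t. - gap k t" 0] by simp
qed

text \<open>Where the slope is at most \<open>k - 3\<close>, it was smaller all the way from 0 on, and the gap has decreased
  strictly since then.\<close>

lemma gap_less_gap_0_if_slope_small:
  assumes "0 < x" "slope k x \<le> k - 3"
  shows "gap k x < gap k 0"
proof (rule DERIV_neg_imp_decreasing_open[OF assms(1)])
  fix t assume t: "0 < t" "t < x"
  then have "slope k t < k - 3"
    using assms slope_strict_mono[of t x] by simp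
  moreover obtain c where "0 < c" "(gap k has_real_derivative c * (slope k t - (k - 3))) (at t)"
    using gap_derivative_sign[of t] less_imp_le[OF t(1)] by blast
  ultimately show "\<exists>d. (gap k has_real_derivative d) (at t) \<and> d < 0"
    by (intro exI[of _ "c * (slope k t - (k - 3))"]) (simp add: mult_pos_neg)
next
  show "continuous_on {0..x} (gap k)"
    using gap_has_derivative by (intro DERIV_atLeastAtMost_imp_continuous_on) blast
qed

end

lemma g_0: "0 < k \<Longrightarrow> g k 0 = sqrt k"
  by (simp add: g_def real_div_sqrt)

lemma V0_0: "V0 0 = sqrt pi"
  by (simp add: V0_eq_gauss_tail gauss_tail_0)

lemma V0_less_g_4:
  assumes "0 \<le> x"
  shows "V0 x < g 4 x"
proof -
  have "\<exists>d. (gap 4 has_real_derivative d) (at t) \<and> d < 0" if t: "x \<le> t" for t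
  proof -
    obtain c where "0 < c" "(gap 4 has_real_derivative c * (slope 4 t - (4 - 3))) (at t)"
      using gap_derivative_sign[of 4 t] order_trans[OF assms t] by auto
    \<comment> \<open>For \<open>k = 4\<close> the threshold \<open>k - 3\<close> is 1, the limit that the slope never reaches.\<close>
    then show ?thesis
      using slope_less_1[of 4 t]
      by (intro exI[of _ "c * (slope 4 t - (4 - 3))"]) (simp add: mult_pos_neg)
  qed
  then have "0 < gap 4 x"
    by (rule DERIV_neg_imp_decreasing_at_top) (simp_all add: gap_tendsto_0)
  then show ?thesis by (simp add: gap_pos_iff)
qed

lemma g_pi_less_V0:
  assumes "0 < x"
  shows "g pi x < V0 x"
proof -
  \<comment> \<open>On either side of the threshold \<open>pi - 3\<close> the gap is compared with a zero: at 0 or at infinity.\<close>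
  have "gap pi 0 = 0"
    by (simp add: gap_eq g_0 V0_0)
  then have "gap pi x < 0"
    using gap_neg_if_slope_large[of pi x] gap_less_gap_0_if_slope_small[of pi x] assms
    by (cases "pi - 3 < slope pi x") auto
  then show ?thesis by (simp add: gap_neg_iff)
qed

text \<open>The slope tends to 1, so for \<open>k < 4\<close> it eventually exceeds the threshold \<open>k - 3\<close>.\<close>

lemma g_less_V0_eventually:
  assumes "0 < k" "k < 4"
  shows "\<forall>\<^sub>F x in at_top. g k x < V0 x"
proof -
  have "\<forall>\<^sub>F x in at_top. k - 3 < slope k x"
    using order_tendstoD(1)[OF slope_tendsto_1[OF assms(1)]] assms by simp
  then show ?thesis
    using eventually_ge_at_top[of 0]
    by eventually_elim (simp add: gap_neg_if_slope_large[OF assms(1)] flip: gap_neg_iff)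
qed

theorem theorem20:
  shows "(\<forall>x\<ge>0. g pi x \<le> V0 x \<and> V0 x < g 4 x)
    \<and> (\<forall>x\<ge>0. g pi x = V0 x \<longleftrightarrow> x = 0)
    \<and> g pi 0 = sqrt pi \<and> V0 0 = sqrt pi
    \<and> (\<forall>k>pi. \<exists>x\<ge>0. \<not> g k x \<le> V0 x)
    \<and> (\<forall>k. 0 < k \<and> k < 4 \<longrightarrow> (\<exists>x\<ge>0. \<not> V0 x \<le> g k x))"
proof (intro conjI allI impI)
  show "g pi 0 = sqrt pi" "V0 0 = sqrt pi"
    by (simp_all add: g_0 V0_0)
  then have at_0: "g pi 0 = V0 0" by simp
  fix x :: real assume x: "0 \<le> x"
  show "V0 x < g 4 x"
    using x by (rule V0_less_g_4)
  show "g pi x \<le> V0 x" "g pi x = V0 x \<longleftrightarrow> x = 0"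
    using x at_0 g_pi_less_V0[of x] by (cases "x = 0"; simp)+
next
  fix k :: real assume "pi < k"
  then have "\<not> g k 0 \<le> V0 0"
    using g_0[of k] V0_0 pi_gt_zero by simp
  then show "\<exists>x\<ge>0. \<not> g k x \<le> V0 x" by blast
next
  fix k :: real assume "0 < k \<and> k < 4"
  then have "\<forall>\<^sub>F x in at_top. g k x < V0 x \<and> 0 \<le> x"
    using g_less_V0_eventually eventually_ge_at_top[of 0] by (intro eventually_conj) auto
  then obtain x where "g k x < V0 x" "0 \<le> x"
    using eventually_happens[of _ "at_top :: real filter"] by force
  then show "\<exists>x\<ge>0. \<not> V0 x \<le> g k x" by (intro exI[of _ x]) simp
qed

end
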